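(* Let $(\mathcal L;\leq,\odot,1)$ be a non-trivial q.n.c. tomonoid, let $F$ be a non-trivial filter of $\mathcal L$ that is a semilattice and such that each $F$-class is order-isomorphic to a real interval, and let $\mathcal P$ be the quotient of $\mathcal L$ by $F$. Assume that for each $F$-class $R$ that is not a singleton there is a bijection $\nu_R\colon F\to R$ such that one of the following holds: either $\nu_R$ is order-preserving and, for any $f\in F$, \[ \mathrm{fp}(\lambda_f)\cap R=\{r\in R: r\leq\nu_R(f)\}, \] or $\nu_R$ is order-reversing and, for any $f\in F$, \[ \mathrm{fp}(\lambda_f)\cap R=\{r\in R: r>\nu_R(f)\text{ or } r\text{ is the smallest element of }R\}. \] Let $R\in\mathcal P$ not be a singleton. Then $\Lambda^R$ is either a Gödel or a reversed Gödel composition tomonoid.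
   Context: Tomonoids. A tomonoid is a structure $(\mathcal L;\leq,\odot,1)$ where $(\mathcal L;\odot,1)$ is a monoid and $\leq$ is a total order such that $a\leq b$, $c\leq d$ imply $a\odot c\leq b\odot d$. It is commutative if $\odot$ is; negative if $a\leq 1$ for all $a$; quantic if every non-empty subset has a supremum and $a\odot\bigvee_\iota b_\iota=\bigvee_\iota(a\odot b_\iota)$, $(\bigvee_\iota b_\iota)\odot a=\bigvee_\iota(b_\iota\odot a)$ for all $a$ and all non-empty families $(b_\iota)$. "q.n.c." means quantic, negative, commutative. A tomonoid is trivial if it consists of $1$ alone. It is a semilattice if $a\odot b=a\wedge b$ (the minimum) for all $a,b$. Filters and quotients. A filter of $\mathcal L$ is a subset $F\ni 1$ closed under $\odot$ and upward closed, regarded as a tomonoid with the restricted structure; it is non-trivial if $F\neq\{1\}$. The congruence induced by $F$: $a\sim_F b$ iff $a=b$, or $a<b$ and $b\odot f\leq a$ for some $f\in F$, or $b<a$ and $a\odot f\leq b$ for some $f\in F$. Its classes, which are intervals of $\mathcal L$, are the $F$-classes; the quotient $\mathcal P$ is the set of $F$-classes with the induced order and product. A real interval is a singleton or a set $(a,b),(a,b],[a,b)$ or $[a,b]$ with $a<b$ in $\mathbb R$. Translations. For $a\in\mathcal L$ let $\lambda_a\colon\mathcal L\to\mathcal L$, $x\mapsto a\odot x$, and $\mathrm{fp}(\lambda)=\{a\in\mathcal L:\lambda(a)=a\}$. For an $F$-class $R$ and $f\in F$, $\lambda_f^R\colon R\to R$ is the restriction of $\lambda_f$ to $R$, and $\Lambda^R=\{\lambda^R_f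 : f\in F\}$ (with pointwise order, composition and $\mathrm{id}_R$). Gödel and reversed Gödel. For a chain $R$, the Gödel composition tomonoid on $R$ is the set of all maps $\lambda_t\colon R\to R$, $x\mapsto x\wedge t$, $t\in R$. For a chain $R$ with bottom element $0$, the reversed Gödel composition tomonoid on $R$ is the set of all maps $\lambda_t\colon R\to R$ with $\lambda_t(x)=0$ if $x\leq t$ and $\lambda_t(x)=x$ if $x>t$, $t\in R$. (Both with pointwise order and composition.) *)

theory Defs
  imports Complex_Main "HOL-Algebra.Group"
begin

section \<open>Tomonoids\<close>

record 'a tomonoid = "'a monoid" +
  leq :: "['a, 'a] \<Rightarrow> bool" (infixl \<open>\<preceq>\<index>\<close> 50)

text \<open>
  The chain formed by a subset \<open>X\<close> of a tomonoid \<open>L\<close>, as an order structure of HOL-Algebra.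
\<close>

definition chain_on :: "('a, 'b) tomonoid_scheme \<Rightarrow> 'a set \<Rightarrow> 'a gorder" where
  "chain_on L X = \<lparr>carrier = X, eq = (=), le = leq L\<rparr>"

abbreviation chain_of :: "('a, 'b) tomonoid_scheme \<Rightarrow> 'a gorder" where
  "chain_of L \<equiv> chain_on L (carrier L)"

locale tomonoid = monoid L for L (structure) +
  assumes total_order: "total_order (chain_of L)"
    and mult_mono: "\<lbrakk>a \<in> carrier L; b \<in> carrier L; c \<in> carrier L; d \<in> carrier L;
      a \<preceq> b; c \<preceq> d\<rbrakk> \<Longrightarrow> a \<otimes> c \<preceq> b \<otimes> d"

text \<open>A non-empty family \<open>(b\<^sub>\<iota>)\<close> enters only through its range \<open>S\<close>.\<close>

locale qnc_tomonoid = tomonoid L + comm_monoid L for L (structure) +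
  assumes negative: "a \<in> carrier L \<Longrightarrow> a \<preceq> \<one>"
    and sup_exists: "\<lbrakk>S \<subseteq> carrier L; S \<noteq> {}\<rbrakk> \<Longrightarrow> \<exists>s. is_lub (chain_of L) s S"
    and mult_sup_left: "\<lbrakk>a \<in> carrier L; S \<subseteq> carrier L; S \<noteq> {}; is_lub (chain_of L) s S\<rbrakk>
      \<Longrightarrow> is_lub (chain_of L) (a \<otimes> s) ((\<lambda>b. a \<otimes> b) ` S)"
    and mult_sup_right: "\<lbrakk>a \<in> carrier L; S \<subseteq> carrier L; S \<noteq> {}; is_lub (chain_of L) s S\<rbrakk>
      \<Longrightarrow> is_lub (chain_of L) (s \<otimes> a) ((\<lambda>b. b \<otimes> a) ` S)"

definition trivial_tomonoid :: "('a, 'b) tomonoid_scheme \<Rightarrow> bool" where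
  "trivial_tomonoid L \<longleftrightarrow> carrier L = {\<one>\<^bsub>L\<^esub>}"

definition chain_min :: "('a, 'c) gorder_scheme \<Rightarrow> 'a \<Rightarrow> 'a \<Rightarrow> 'a" where
  "chain_min C x y = (if x \<sqsubseteq>\<^bsub>C\<^esub> y then x else y)"

definition semilattice_tomonoid :: "('a, 'b) tomonoid_scheme \<Rightarrow> bool" where
  "semilattice_tomonoid L \<longleftrightarrow>
    (\<forall>a\<in>carrier L. \<forall>b\<in>carrier L. a \<otimes>\<^bsub>L\<^esub> b = chain_min (chain_of L) a b)"


section \<open>Filters and quotients\<close>

definition tomonoid_filter :: "('a, 'b) tomonoid_scheme \<Rightarrow> 'a set \<Rightarrow> bool" where
  "tomonoid_filter L F \<longleftrightarrow> F \<subseteq> carrier L \<and> \<one>\<^bsub>L\<^esub> \<in> F \<and>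
    (\<forall>f\<in>F. \<forall>g\<in>F. f \<otimes>\<^bsub>L\<^esub> g \<in> F) \<and>
    (\<forall>f\<in>F. \<forall>a\<in>carrier L. f \<preceq>\<^bsub>L\<^esub> a \<longrightarrow> a \<in> F)"

abbreviation sub_tomonoid :: "('a, 'b) tomonoid_scheme \<Rightarrow> 'a set \<Rightarrow> ('a, 'b) tomonoid_scheme" where
  "sub_tomonoid L F \<equiv> L\<lparr>carrier := F\<rparr>"

definition filter_cong :: "('a, 'b) tomonoid_scheme \<Rightarrow> 'a set \<Rightarrow> ('a \<times> 'a) set" where
  "filter_cong L F = {(a, b). a \<in> carrier L \<and> b \<in> carrier L \<and>
    (a = b \<or>
     a \<preceq>\<^bsub>L\<^esub> b \<and> a \<noteq> b \<and> (\<exists>f\<in>F. b \<otimes>\<^bsub>L\<^esub> f \<preceq>\<^bsub>L\<^esub> a) \<or>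
     b \<preceq>\<^bsub>L\<^esub> a \<and> b \<noteq> a \<and> (\<exists>f\<in>F. a \<otimes>\<^bsub>L\<^esub> f \<preceq>\<^bsub>L\<^esub> b))}"

text \<open>
  The carrier consists of the \<open>F\<close>-classes. Product and order are induced by representatives; the
  union below is that of a single class, as the product respects the congruence.
\<close>

definition quotient_tomonoid :: "('a, 'b) tomonoid_scheme \<Rightarrow> 'a set \<Rightarrow> 'a set tomonoid" where
  "quotient_tomonoid L F =
    \<lparr>carrier = carrier L // filter_cong L F,
     mult = (\<lambda>A B. \<Union>a\<in>A. \<Union>b\<in>B. filter_cong L F `` {a \<otimes>\<^bsub>L\<^esub> b}),
     one = filter_cong L F `` {\<one>\<^bsub>L\<^esub>},
     leq = (\<lambda>A B. \<exists>a\<in>A. \<exists>b\<in>B. a \<preceq>\<^bsub>L\<^esub> b)\<rparr>"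

definition real_interval :: "real set \<Rightarrow> bool" where
  "real_interval I \<longleftrightarrow> (\<exists>a. I = {a}) \<or>
    (\<exists>a b. a < b \<and> (I = {a<..<b} \<or> I = {a<..b} \<or> I = {a..<b} \<or> I = {a..b}))"

definition iso_real_interval :: "('a, 'c) gorder_scheme \<Rightarrow> bool" where
  "iso_real_interval C \<longleftrightarrow> (\<exists>I \<phi>. real_interval I \<and> bij_betw \<phi> (carrier C) I \<and>
    (\<forall>x\<in>carrier C. \<forall>y\<in>carrier C. x \<sqsubseteq>\<^bsub>C\<^esub> y \<longleftrightarrow> \<phi> x \<le> \<phi> y))"


section \<open>Translations and composition tomonoids\<close>

text \<open>Maps from \<open>X\<close> to \<open>X\<close> are represented by functions that are \<open>undefined\<close> outside \<open>X\<close>.\<close>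

definition translation :: "('a, 'b) tomonoid_scheme \<Rightarrow> 'a \<Rightarrow> 'a \<Rightarrow> 'a" where
  "translation L a = (\<lambda>x\<in>carrier L. a \<otimes>\<^bsub>L\<^esub> x)"

definition fp :: "('a, 'b) tomonoid_scheme \<Rightarrow> ('a \<Rightarrow> 'a) \<Rightarrow> 'a set" where
  "fp L h = {a \<in> carrier L. h a = a}"

definition comp_tomonoid :: "('a, 'c) gorder_scheme \<Rightarrow> ('a \<Rightarrow> 'a) set \<Rightarrow> ('a \<Rightarrow> 'a) tomonoid" where
  "comp_tomonoid C M =
    \<lparr>carrier = M,
     mult = compose (carrier C),
     one = (\<lambda>x\<in>carrier C. x),
     leq = (\<lambda>g h. \<forall>x\<in>carrier C. g x \<sqsubseteq>\<^bsub>C\<^esub> h x)\<rparr>"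

definition class_translations ::
  "('a, 'b) tomonoid_scheme \<Rightarrow> 'a set \<Rightarrow> 'a set \<Rightarrow> ('a \<Rightarrow> 'a) tomonoid" where
  "class_translations L F R =
    comp_tomonoid (chain_on L R) {restrict (translation L f) R | f. f \<in> F}"

definition goedel_tomonoid :: "('a, 'c) gorder_scheme \<Rightarrow> ('a \<Rightarrow> 'a) tomonoid" where
  "goedel_tomonoid C = comp_tomonoid C {(\<lambda>x\<in>carrier C. chain_min C x t) | t. t \<in> carrier C}"

text \<open>The parameter \<open>z\<close> is meant to be the bottom element of \<open>C\<close>.\<close>

definition reversed_goedel_tomonoid ::
  "('a, 'c) gorder_scheme \<Rightarrow> 'a \<Rightarrow> ('a \<Rightarrow> 'a) tomonoid" where
  "reversed_goedel_tomonoid C z =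
    comp_tomonoid C {(\<lambda>x\<in>carrier C. if x \<sqsubseteq>\<^bsub>C\<^esub> t then z else x) | t. t \<in> carrier C}"

definition is_goedel_tomonoid :: "('a, 'c) gorder_scheme \<Rightarrow> ('a \<Rightarrow> 'a) tomonoid \<Rightarrow> bool" where
  "is_goedel_tomonoid C M \<longleftrightarrow> M = goedel_tomonoid C"

definition is_reversed_goedel_tomonoid ::
  "('a, 'c) gorder_scheme \<Rightarrow> ('a \<Rightarrow> 'a) tomonoid \<Rightarrow> bool" where
  "is_reversed_goedel_tomonoid C M \<longleftrightarrow>
    (\<exists>z. least C z (carrier C) \<and> M = reversed_goedel_tomonoid C z)"

end

theory Submission
  imports Defs
begin

text \<open>
  Every \<open>f\<close> in the semilattice \<open>F\<close> is idempotent, so the translation by \<open>f\<close> is a monotone,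
  decreasing and idempotent map, and it sends each \<open>F\<close>-class \<open>R\<close> into itself. Such a map is
  determined by its fixed points: the value at \<open>x\<close> is the largest fixed point below \<open>x\<close>.

  Hence, if the fixed points in \<open>R\<close> are the elements below \<open>t\<close>, the map on \<open>R\<close> is
  \<open>x \<mapsto> x \<and> t\<close>. If they are the elements strictly above \<open>t\<close> together with the smallest element
  of \<open>R\<close>, then every \<open>x \<le> t\<close> is sent to a fixed point that is not above \<open>t\<close>, that is, to the
  smallest element; in particular, the value at \<open>t\<close> shows that \<open>R\<close> does have a smallest element. As
  \<open>t = \<nu>\<^sub>R(f)\<close> runs through all of \<open>R\<close>, the maps obtained are exactly those of the (reversed)
  Goedel composition tomonoid.
\<close>

context tomonoid
begin

lemma leq_refl: "a \<in> carrier L \<Longrightarrow> a \<preceq> a"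
  and leq_antisym: "\<lbrakk>a \<preceq> b; b \<preceq> a; a \<in> carrier L; b \<in> carrier L\<rbrakk> \<Longrightarrow> a = b"
  and leq_trans: "\<lbrakk>a \<preceq> b; b \<preceq> c; a \<in> carrier L; b \<in> carrier L; c \<in> carrier L\<rbrakk> \<Longrightarrow> a \<preceq> c"
  and leq_linear: "\<lbrakk>a \<in> carrier L; b \<in> carrier L\<rbrakk> \<Longrightarrow> a \<preceq> b \<or> b \<preceq> a"
proof -
  interpret total_order "chain_of L" by (rule total_order)
  show "a \<in> carrier L \<Longrightarrow> a \<preceq> a"
    using le_refl[of a] by (simp add: chain_on_def)
  show "\<lbrakk>a \<preceq> b; b \<preceq> a; a \<in> carrier L; b \<in> carrier L\<rbrakk> \<Longrightarrow> a = b"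
    using le_antisym[of a b] by (simp add: chain_on_def)
  show "\<lbrakk>a \<preceq> b; b \<preceq> c; a \<in> carrier L; b \<in> carrier L; c \<in> carrier L\<rbrakk> \<Longrightarrow> a \<preceq> c"
    using le_trans[of a b c] by (simp add: chain_on_def)
  show "\<lbrakk>a \<in> carrier L; b \<in> carrier L\<rbrakk> \<Longrightarrow> a \<preceq> b \<or> b \<preceq> a"
    using total_order_total[of a b] by (simp add: chain_on_def)
qed

end

context qnc_tomonoid
begin

lemma mult_leq_left: "\<lbrakk>a \<in> carrier L; b \<in> carrier L\<rbrakk> \<Longrightarrow> a \<otimes> b \<preceq> a"
  using mult_mono[of a a b \<one>] by (simp add: leq_refl negative)

lemma mult_leq_right: "\<lbrakk>a \<in> carrier L; b \<in> carrier L\<rbrakk> \<Longrightarrow> a \<otimes> b \<preceq> b"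
  using mult_leq_left[of b a] by (simp add: m_comm)

text \<open>
  By negativity, of the two inequalities below the one for the smaller element always holds, so the
  case distinction in the definition of the congruence is not needed.
\<close>

lemma filter_cong_iff:
  assumes F: "tomonoid_filter L F"
  shows "(a, b) \<in> filter_cong L F \<longleftrightarrow>
    a \<in> carrier L \<and> b \<in> carrier L \<and> (\<exists>f\<in>F. a \<otimes> f \<preceq> b \<and> b \<otimes> f \<preceq> a)"
proof -
  have FL: "F \<subseteq> carrier L" and one: "\<one> \<in> F"
    using F by (auto simp: tomonoid_filter_def)
  have below: "\<exists>f\<in>F. x \<otimes> f \<preceq> y \<and> y \<otimes> f \<preceq> x"
    if "x \<in> carrier L" "y \<in> carrier L" "x \<preceq> y" "f \<in> F" "y \<otimes> f \<preceq> x" for x y f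
    using that FL leq_trans[of "x \<otimes> f" x y] mult_leq_left[of x f] by blast
  have "\<exists>f\<in>F. x \<otimes> f \<preceq> x \<and> x \<otimes> f \<preceq> x" if "x \<in> carrier L" for x
    using that one leq_refl by (intro bexI[of _ \<one>]) simp_all
  then show ?thesis
    unfolding filter_cong_def using below leq_linear by blast
qed

text \<open>
  If \<open>g\<close> witnesses that \<open>x\<close> is congruent to a representative \<open>r\<close>, then \<open>g \<otimes> f\<close> witnesses that
  \<open>f \<otimes> x\<close> is.
\<close>

lemma filter_class_mult_closed:
  assumes F: "tomonoid_filter L F" and R: "R \<in> carrier (quotient_tomonoid L F)"
    and f: "f \<in> F" and x: "x \<in> R"
  shows "f \<otimes> x \<in> R"
proof -
  obtain r where R_eq: "R = filter_cong L F `` {r}"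
    using R by (auto simp: quotient_tomonoid_def elim: quotientE)
  then obtain g where g: "g \<in> F" and r: "r \<in> carrier L" and xL: "x \<in> carrier L"
    and rg: "r \<otimes> g \<preceq> x" and xg: "x \<otimes> g \<preceq> r"
    using x filter_cong_iff[OF F] by auto
  have fL: "f \<in> carrier L" and gL: "g \<in> carrier L" and gf: "g \<otimes> f \<in> F"
    using F f g by (auto simp: tomonoid_filter_def)
  have "(r \<otimes> g) \<otimes> f \<preceq> x \<otimes> f"
    using rg r gL fL xL by (intro mult_mono leq_refl) auto
  then have 1: "r \<otimes> (g \<otimes> f) \<preceq> f \<otimes> x"
    using r gL fL xL by (simp add: m_ac)
  have "(f \<otimes> x) \<otimes> (g \<otimes> f) = (f \<otimes> f) \<otimes> (x \<otimes> g)"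
    using gL fL xL by (simp add: m_ac)
  also have "\<dots> \<preceq> x \<otimes> g"
    using fL xL gL by (intro mult_leq_right) auto
  finally have 2: "(f \<otimes> x) \<otimes> (g \<otimes> f) \<preceq> r"
    using xg leq_trans[of "(f \<otimes> x) \<otimes> (g \<otimes> f)" "x \<otimes> g" r] fL xL gL r by auto
  show ?thesis
    unfolding R_eq using 1 2 gf r fL xL filter_cong_iff[OF F] by auto
qed

lemma filter_class_subset:
  assumes "tomonoid_filter L F" "R \<in> carrier (quotient_tomonoid L F)"
  shows "R \<subseteq> carrier L"
  using assms filter_cong_iff by (auto simp: quotient_tomonoid_def elim!: quotientE)

lemma idem_mult_eq_min:
  assumes f: "f \<in> carrier L" "f \<otimes> f = f" and R: "R \<subseteq> carrier L"
    and closed: "\<And>y. y \<in> R \<Longrightarrow> f \<otimes> y \<in> R"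
    and t: "t \<in> R" and fixed: "fp L (translation L f) \<inter> R = {r \<in> R. r \<preceq> t}"
    and x: "x \<in> R"
  shows "f \<otimes> x = chain_min (chain_on L R) x t"
proof -
  have xL: "x \<in> carrier L" and tL: "t \<in> carrier L"
    using R x t by auto
  have fixed_iff: "f \<otimes> y = y \<longleftrightarrow> y \<preceq> t" if "y \<in> R" for y
  proof -
    have "f \<otimes> y = y \<longleftrightarrow> y \<in> fp L (translation L f) \<inter> R"
      using that R by (auto simp: fp_def translation_def)
    then show ?thesis
      using that by (simp add: fixed)
  qed
  show ?thesis
  proof (cases "x \<preceq> t")
    case True
    then show ?thesis
      using fixed_iff x by (simp add: chain_min_def chain_on_def)
  next
    case False
    then have tx: "t \<preceq> x"
      using leq_linear xL tL by blast
    have "f \<otimes> (f \<otimes> x) = f \<otimes> x"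
      using f xL by (metis m_assoc)
    then have "f \<otimes> x \<preceq> t"
      using fixed_iff closed x by blast
    moreover have "f \<otimes> t = t"
      using fixed_iff[OF t] leq_refl[OF tL] by simp
    then have "t \<preceq> f \<otimes> x"
      using mult_mono[of f f t x] f(1) tL xL tx leq_refl by simp
    ultimately show ?thesis
      using False leq_antisym f(1) xL tL by (simp add: chain_min_def chain_on_def)
  qed
qed

text \<open>
  The last conclusion applies with \<open>x = t\<close>, so that the assumptions force \<open>R\<close> to have a smallest
  element.
\<close>

lemma idem_mult_above_or_least:
  assumes f: "f \<in> carrier L" "f \<otimes> f = f" and R: "R \<subseteq> carrier L"
    and closed: "\<And>y. y \<in> R \<Longrightarrow> f \<otimes> y \<in> R"
    and t: "t \<in> R"
    and fixed: "fp L (translation L f) \<inter> R =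
      {r \<in> R. t \<preceq> r \<and> r \<noteq> t \<or> least (chain_on L R) r R}"
    and x: "x \<in> R"
  shows "\<not> x \<preceq> t \<Longrightarrow> f \<otimes> x = x" and "x \<preceq> t \<Longrightarrow> least (chain_on L R) (f \<otimes> x) R"
proof -
  have xL: "x \<in> carrier L" and tL: "t \<in> carrier L"
    using R x t by auto
  have fixed_iff: "f \<otimes> y = y \<longleftrightarrow> t \<preceq> y \<and> y \<noteq> t \<or> least (chain_on L R) y R" if "y \<in> R" for y
  proof -
    have "f \<otimes> y = y \<longleftrightarrow> y \<in> fp L (translation L f) \<inter> R"
      using that R by (auto simp: fp_def translation_def)
    then show ?thesis
      using that by (simp add: fixed)
  qed
  show "f \<otimes> x = x" if "\<not> x \<preceq> t"
    using that fixed_iff[OF x] leq_linear[OF xL tL] leq_refl[OF xL] by auto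
  show "least (chain_on L R) (f \<otimes> x) R" if "x \<preceq> t"
  proof -
    have "f \<otimes> (f \<otimes> x) = f \<otimes> x"
      using f xL by (metis m_assoc)
    then have "t \<preceq> f \<otimes> x \<and> f \<otimes> x \<noteq> t \<or> least (chain_on L R) (f \<otimes> x) R"
      using fixed_iff closed x by blast
    moreover have "f \<otimes> x \<preceq> t"
      using leq_trans[OF mult_leq_right that] f(1) xL tL by simp
    ultimately show ?thesis
      using leq_antisym f(1) xL tL by (meson m_closed)
  qed
qed

end

theorem theorem5p5:
  fixes L :: "('a, 'b) tomonoid_scheme" (structure)
    and F :: "'a set" and P :: "'a set tomonoid" and R :: "'a set"
  assumes "qnc_tomonoid L" and "\<not> trivial_tomonoid L"
    and "tomonoid_filter L F" and "\<not> trivial_tomonoid (sub_tomonoid L F)"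
    and "semilattice_tomonoid (sub_tomonoid L F)"
    and "P = quotient_tomonoid L F"
    and "\<forall>Q\<in>carrier P. iso_real_interval (chain_on L Q)"
    and "\<forall>Q\<in>carrier P. \<not> is_singleton Q \<longrightarrow> (\<exists>\<nu>. bij_betw \<nu> F Q \<and>
      (monotone_on F (\<preceq>) (\<preceq>) \<nu> \<and>
         (\<forall>f\<in>F. fp L (translation L f) \<inter> Q = {r\<in>Q. r \<preceq> \<nu> f}) \<or>
       monotone_on F (\<preceq>) (\<lambda>x y. y \<preceq> x) \<nu> \<and>
         (\<forall>f\<in>F. fp L (translation L f) \<inter> Q =
           {r\<in>Q. \<nu> f \<preceq> r \<and> r \<noteq> \<nu> f \<or> least (chain_on L Q) r Q})))"
    and "R \<in> carrier P" and "\<not> is_singleton R"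
  shows "is_goedel_tomonoid (chain_on L R) (class_translations L F R) \<or>
    is_reversed_goedel_tomonoid (chain_on L R) (class_translations L F R)"
proof -
  interpret qnc_tomonoid L by (rule assms(1))
  have F: "tomonoid_filter L F" and R: "R \<in> carrier (quotient_tomonoid L F)"
    using assms by auto
  have RL: "R \<subseteq> carrier L"
    by (rule filter_class_subset[OF F R])
  have FL: "f \<in> carrier L" if "f \<in> F" for f
    using F that by (auto simp: tomonoid_filter_def)
  have idem: "f \<otimes> f = f" if "f \<in> F" for f
    using assms(5) that by (auto simp: semilattice_tomonoid_def chain_min_def)
  note closed = filter_class_mult_closed[OF F R]
  have restr: "restrict (translation L f) R = (\<lambda>x\<in>R. f \<otimes> x)" for f
    using RL by (auto simp: translation_def restrict_def fun_eq_iff)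
  have carrier_R: "carrier (chain_on L R) = R" and le_R: "le (chain_on L R) = (\<preceq>)"
    by (simp_all add: chain_on_def)
  obtain \<nu> where bij: "bij_betw \<nu> F R"
    and cases:
      "(\<forall>f\<in>F. fp L (translation L f) \<inter> R = {r\<in>R. r \<preceq> \<nu> f}) \<or>
       (\<forall>f\<in>F. fp L (translation L f) \<inter> R =
         {r\<in>R. \<nu> f \<preceq> r \<and> r \<noteq> \<nu> f \<or> least (chain_on L R) r R})"
    using assms(8,9,10) by blast
  have \<nu>R: "\<nu> f \<in> R" if "f \<in> F" for f
    using bij that by (auto simp: bij_betw_def)
  \<comment> \<open>As \<open>\<nu>\<close> is onto \<open>R\<close>, a family of maps indexed by \<open>R\<close> may be reindexed by \<open>F\<close>.\<close>
  have family: "{restrict (translation L f) R |f. f \<in> F} = {h t |t. t \<in> R}"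
    if "\<And>f. f \<in> F \<Longrightarrow> (\<lambda>x\<in>R. f \<otimes> x) = h (\<nu> f)" for h
  proof -
    have "{restrict (translation L f) R |f. f \<in> F} = (\<lambda>f. \<lambda>x\<in>R. f \<otimes> x) ` F"
      by (auto simp: restr)
    also have "\<dots> = (\<lambda>f. h (\<nu> f)) ` F"
      using that by (intro image_cong) simp_all
    also have "\<dots> = h ` R"
      using bij by (auto simp: bij_betw_def)
    finally show ?thesis by auto
  qed
  from cases show ?thesis
  proof
    assume fixed: "\<forall>f\<in>F. fp L (translation L f) \<inter> R = {r\<in>R. r \<preceq> \<nu> f}"
    have "(\<lambda>x\<in>R. f \<otimes> x) = (\<lambda>x\<in>R. chain_min (chain_on L R) x (\<nu> f))" if "f \<in> F" for f
      using idem_mult_eq_min[OF FL idem RL closed \<nu>R] that fixed by (auto intro!: restrict_ext)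
    then have "is_goedel_tomonoid (chain_on L R) (class_translations L F R)"
      unfolding is_goedel_tomonoid_def goedel_tomonoid_def class_translations_def carrier_R
      by (subst family[of "\<lambda>t. \<lambda>x\<in>R. chain_min (chain_on L R) x t"]) simp_all
    then show ?thesis ..
  next
    assume fixed: "\<forall>f\<in>F. fp L (translation L f) \<inter> R =
      {r\<in>R. \<nu> f \<preceq> r \<and> r \<noteq> \<nu> f \<or> least (chain_on L R) r R}"
    have above: "f \<otimes> x = x" if "f \<in> F" "x \<in> R" "\<not> x \<preceq> \<nu> f" for f x
      using idem_mult_above_or_least(1)[OF FL idem RL closed \<nu>R] that fixed by simp
    have below: "least (chain_on L R) (f \<otimes> x) R" if "f \<in> F" "x \<in> R" "x \<preceq> \<nu> f" for f x
      using idem_mult_above_or_least(2)[OF FL idem RL closed \<nu>R] that fixed by simp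
    have "\<one> \<in> F"
      using F by (simp add: tomonoid_filter_def)
    \<comment> \<open>Any \<open>f \<in> F\<close> would do in place of \<open>\<one>\<close>: translation by \<open>f\<close> sends \<open>\<nu> f\<close> to the bottom.\<close>
    define z where "z = \<one> \<otimes> \<nu> \<one>"
    have z: "least (chain_on L R) z R"
      unfolding z_def using \<open>\<one> \<in> F\<close> \<nu>R RL by (intro below leq_refl) auto
    have least_unique: "y = z" if "least (chain_on L R) y R" for y
      using that z RL leq_antisym[of y z] by (auto simp: least_def carrier_R le_R)
    have "(\<lambda>x\<in>R. f \<otimes> x) = (\<lambda>x\<in>R. if x \<preceq> \<nu> f then z else x)" if "f \<in> F" for f
      using that above below least_unique by (intro restrict_ext) auto
    then have "class_translations L F R = reversed_goedel_tomonoid (chain_on L R) z"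
      unfolding reversed_goedel_tomonoid_def class_translations_def carrier_R le_R
      by (subst family[of "\<lambda>t. \<lambda>x\<in>R. if x \<preceq> t then z else x"]) simp_all
    then show ?thesis
      using z by (auto simp: is_reversed_goedel_tomonoid_def carrier_R)
  qed
qed

end
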